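(* For $t,j\in\mathbb{Z}^+$ let $\mathcal{F}^t_j$ denote the equation $tx+jy=z$ in the variables $x,y,z$. Let $t,q,s\in\mathbb{Z}^+$ with $q\ge s\ge t$, and define $m=\frac{\gcd(t,q)}{\gcd(t,q,s)}$. Then $$RR(\mathcal{F}^t_q,\mathcal{F}^t_s)\ \ge\ t(t+q)(t+s)+ms.$$
   Context: For two linear homogeneous equations $\mathcal{E},\mathcal{E}'$ with integer coefficients, each in at least three variables, $RR(\mathcal{E},\mathcal{E}')$ denotes the minimum integer $N$, if it exists, such that any $2$-coloring of $[1,N]=\{1,2,\dots,N\}$ admits either a solution to $\mathcal{E}$ with all entries in $[1,N]$ and of the first color, or a solution to $\mathcal{E}'$ with all entries in $[1,N]$ and of the second color. Entries of solutions need not be distinct. *)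

theory Defs
  imports Main "HOL-Library.Extended_Nat"
begin

(* A linear homogeneous equation a_1 x_1 + ... + a_k x_k = 0 with integer coefficients is
   represented by its coefficient list [a_1, ..., a_k], and a tuple of values by a list of
   the same length.  Entries may repeat. *)
definition solves :: "int list \<Rightarrow> nat list \<Rightarrow> bool" where
  "solves E xs \<longleftrightarrow>
     length xs = length E \<and> (\<Sum>i<length E. E ! i * int (xs ! i)) = 0"

(* Colorings are total functions on nat; only their values on {1..N} matter below.
   True is the first color, False the second. *)
definition has_solution_in_color :: "int list \<Rightarrow> (nat \<Rightarrow> bool) \<Rightarrow> bool \<Rightarrow> nat \<Rightarrow> bool" where
  "has_solution_in_color E c col N \<longleftrightarrow>
     (\<exists>xs. solves E xs \<and> set xs \<subseteq> {1..N} \<and> (\<forall>x\<in>set xs. c x = col))"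

definition admissible :: "int list \<Rightarrow> int list \<Rightarrow> nat \<Rightarrow> bool" where
  "admissible E E' N \<longleftrightarrow>
     (\<forall>c :: nat \<Rightarrow> bool. has_solution_in_color E c True N \<or> has_solution_in_color E' c False N)"

(* The minimum admissible N; if there is none, the infimum of the empty set is \<infinity>.
   Meant for equations in at least three variables (length \<ge> 3, nonzero coefficients). *)
definition RR :: "int list \<Rightarrow> int list \<Rightarrow> enat" where
  "RR E E' = Inf {enat N | N. admissible E E' N}"

(* t x + j y = z, written t x + j y - z = 0. *)
definition eqF :: "nat \<Rightarrow> nat \<Rightarrow> int list" where
  "eqF t j = [int t, int j, - 1]"

end

theory Submission
  imports Defs
begin

text \<open>
  Put \<open>M = (t + q) (t + s)\<close> and \<open>g = gcd t q\<close>. Colour \<open>n\<close> with the second colour iff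
  \<open>n < t + s\<close>, or \<open>n \<ge> M\<close> and \<open>g dvd n\<close>. If \<open>x, y\<close> have the first colour then
  \<open>z = t x + q y\<close> is a multiple of \<open>g\<close> and at least \<open>M\<close>, so it has the second colour.
  If \<open>x, y, z = t x + s y\<close> all have the second colour, then \<open>z \<ge> t + s\<close> forces \<open>z \<ge> M\<close> and
  \<open>g dvd z\<close>; as \<open>x, y < t + s\<close> would give \<open>z < M\<close>, one of \<open>x, y\<close> is at least \<open>M\<close>.
  Moreover \<open>g dvd s y\<close>, so \<open>m dvd y\<close>, and \<open>z \<ge> t M + m s\<close> follows.
\<close>

text \<open>The coefficient \<open>- 1\<close> lets the first two entries determine the third, so
  the list encoding reduces to a choice of \<open>x\<close> and \<open>y\<close>.\<close>

lemma has_solution_in_color_eqF: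
  "has_solution_in_color (eqF t j) c col N \<longleftrightarrow>
     (\<exists>x y. x \<in> {1..N} \<and> y \<in> {1..N} \<and> t * x + j * y \<in> {1..N} \<and>
        c x = col \<and> c y = col \<and> c (t * x + j * y) = col)"
    (is "?L \<longleftrightarrow> ?R")
proof
  assume ?L
  then obtain xs where xs: "solves (eqF t j) xs" "set xs \<subseteq> {1..N}" "\<forall>x\<in>set xs. c x = col"
    by (auto simp: has_solution_in_color_def)
  from xs(1) obtain x y z where eq: "xs = [x, y, z]"
    by (auto simp: solves_def eqF_def length_Suc_conv numeral_3_eq_3)
  with xs(1) have "int z = int (t * x + j * y)"
    by (simp add: solves_def eqF_def numeral_3_eq_3)
  then have "z = t * x + j * y"
    by (simp only: of_nat_eq_iff)
  with xs eq show ?R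
    by auto
next
  assume ?R
  then obtain x y where xy: "x \<in> {1..N}" "y \<in> {1..N}" "t * x + j * y \<in> {1..N}"
      "c x = col" "c y = col" "c (t * x + j * y) = col"
    by blast
  have "solves (eqF t j) [x, y, t * x + j * y]"
    by (simp add: solves_def eqF_def numeral_3_eq_3)
  with xy show ?L
    unfolding has_solution_in_color_def by (intro exI[of _ "[x, y, t * x + j * y]"]) simp
qed

text \<open>\<open>RR\<close> is an infimum, so it suffices to refute each \<open>N < B\<close> by a
  coloring, which may depend on \<open>N\<close>.\<close>

lemma RR_geI:
  assumes "\<And>N. N < B \<Longrightarrow>
    \<exists>c. \<not> has_solution_in_color E c True N \<and> \<not> has_solution_in_color E' c False N"
  shows "enat B \<le> RR E E'"
  unfolding RR_def
proof (rule Inf_greatest)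
  fix n assume "n \<in> {enat N |N. admissible E E' N}"
  then obtain N where "n = enat N" "admissible E E' N"
    by blast
  with assms[of N] show "enat B \<le> n"
    by (auto simp: admissible_def not_less[symmetric])
qed

text \<open>Cancelling \<open>gcd g s\<close> leaves two coprime cofactors, so the cofactor of
  \<open>g\<close> must divide \<open>y\<close>.\<close>

lemma div_gcd_dvd_of_dvd_mult:
  fixes g s y :: nat
  assumes "g > 0" and "g dvd s * y"
  shows "g div gcd g s dvd y"
proof -
  have "coprime (g div gcd g s) (s div gcd g s)"
    using assms(1) by (intro div_gcd_coprime) simp
  moreover have "(gcd g s * (g div gcd g s)) dvd gcd g s * ((s div gcd g s) * y)"
    using assms by (simp add: mult.assoc[symmetric])
  then have "g div gcd g s dvd (s div gcd g s) * y"
    using assms(1) by (subst (asm) nat_mult_dvd_cancel_disj) auto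
  ultimately show ?thesis
    by (simp add: coprime_dvd_mult_right_iff)
qed

theorem theorem2p2:
  fixes t q s m :: nat
  assumes "t > 0" and "q > 0" and "s > 0"
    and "q \<ge> s" and "s \<ge> t"
    and "m = gcd t q div gcd (gcd t q) s"
  shows "RR (eqF t q) (eqF t s) \<ge> enat (t * (t + q) * (t + s) + m * s)"
proof (rule RR_geI)
  fix N assume N: "N < t * (t + q) * (t + s) + m * s"
  define g where "g = gcd t q"
  define M where "M = (t + q) * (t + s)"
  define c where "c n \<longleftrightarrow> t + s \<le> n \<and> (n < M \<or> \<not> g dvd n)" for n
  have g: "g > 0" "g dvd t" "g dvd q"
    using assms(1) by (auto simp: g_def)
  have m: "m = g div gcd g s"
    using assms(6) by (simp add: g_def)
  have "m \<le> t"
    unfolding m by (rule le_trans[OF div_le_dividend dvd_imp_le[OF g(2) assms(1)]])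
  have N: "N < t * M + m * s"
    using N by (simp add: M_def mult.assoc)
  have first: "\<not> has_solution_in_color (eqF t q) c True N"
  proof
    assume "has_solution_in_color (eqF t q) c True N"
    then obtain x y where xy: "c x" "c y" and z: "c (t * x + q * y)"
      by (auto simp: has_solution_in_color_eqF)
    \<comment> \<open>First-color entries are at least \<open>t + s\<close>; the threshold
      \<open>M\<close> is the value of the form at \<open>x = y = t + s\<close>.\<close>
    have "t * (t + s) + q * (t + s) \<le> t * x + q * y"
      using xy by (intro add_mono mult_le_mono2) (auto simp: c_def)
    then have "M \<le> t * x + q * y"
      by (simp add: M_def algebra_simps)
    moreover have "g dvd t * x + q * y"
      using g by simp
    ultimately show False
      using z by (simp add: c_def)
  qed
  have second: "\<not> has_solution_in_color (eqF t s) c False N"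
  proof
    assume "has_solution_in_color (eqF t s) c False N"
    then obtain x y where pos: "1 \<le> x" "1 \<le> y" and zN: "t * x + s * y \<le> N"
      and xy: "\<not> c x" "\<not> c y" and z: "\<not> c (t * x + s * y)"
      by (auto simp: has_solution_in_color_eqF)
    have "t * 1 + s * 1 \<le> t * x + s * y"
      using pos by (intro add_mono mult_le_mono2)
    with z have zM: "M \<le> t * x + s * y" and gz: "g dvd t * x + s * y"
      by (auto simp: c_def)
    from gz g(2) have "g dvd s * y"
      by (simp add: dvd_add_right_iff)
    then have "m dvd y"
      unfolding m using g(1) by (intro div_gcd_dvd_of_dvd_mult)
    with pos have my: "m \<le> y"
      by (auto intro: dvd_imp_le)
    have "M \<le> x \<or> M \<le> y"
    proof (rule ccontr)
      assume "\<not> (M \<le> x \<or> M \<le> y)"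
      with xy have "x < t + s" "y < t + s"
        by (auto simp: c_def)
      then have "t * x + s * y < t * (t + s) + s * (t + s)"
        using assms by (intro add_strict_mono) auto
      \<comment> \<open>Here \<open>s \<le> q\<close> enters: the square of \<open>t + s\<close> is
        at most \<open>M\<close>.\<close>
      also have "\<dots> \<le> M"
        using assms(4) by (simp add: M_def flip: distrib_right)
      finally show False
        using zM by simp
    qed
    then have "t * M + m * s \<le> t * x + s * y"
    proof
      assume "M \<le> x"
      with my show ?thesis
        unfolding mult.commute[of m s] by (intro add_mono mult_le_mono2)
    next
      assume My: "M \<le> y"
      show ?thesis
      \<comment> \<open>For \<open>s > t\<close>, the term \<open>s * y\<close> contains a surplus
        copy of \<open>M\<close>, which covers \<open>m * s\<close> because
        \<open>m \<le> t\<close>. For \<open>s = t\<close> there is no surplus, but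
        \<open>m = 1\<close> and \<open>x \<ge> 1\<close> supplies the missing
        \<open>t\<close>.\<close>
      proof (cases "s = t")
        case True
        then have "gcd g s = g"
          using g(2) by (simp add: gcd_nat.absorb1)
        then have "m = 1"
          using g(1) m by simp
        moreover have "t * 1 + t * M \<le> t * x + t * y"
          using My pos by (intro add_mono mult_le_mono2)
        ultimately show ?thesis
          using True by simp
      next
        case False
        have "t * s \<le> M"
          by (simp add: M_def algebra_simps)
        moreover have "m * s \<le> t * s"
          using \<open>m \<le> t\<close> by simp
        moreover have "Suc t * M \<le> s * y"
          using False assms(5) My by (intro mult_le_mono) auto
        ultimately show ?thesis
          unfolding mult_Suc by linarith
      qed
    qed
    with zN N show False
      by simp
  qed
  from first second show "\<exists>c. \<not> has_solution_in_color (eqF t q) c True N \<and>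
      \<not> has_solution_in_color (eqF t s) c False N"
    by blast
qed

end
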